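(* Let $(w_j)_{j\ge 0}$ be a sequence of real numbers with $w_j>0$ for all $j$, $\liminf_{j} |w_j|^{1/j}=1$, and $\sup_j \frac{w_{j+1}}{w_j}<\infty$. Then the backward shift operator $T$ on the space $$H^2_w=\Big\{f=\sum_{j=0}^{\infty} a_jz^j : \sum_{j=0}^{\infty} |a_j|^2w_j < \infty\Big\}$$ is not subnormal.
   Context: $H^2_w$ is a Hilbert space with norm $\|f\|^2=\sum_{j=0}^\infty |a_j|^2 w_j$ for $f=\sum_j a_jz^j$. The backward shift operator on $H^2_w$ is the adjoint of the (bounded) forward shift $f(z)\mapsto zf(z)$; explicitly, $$T\Big(\sum_{j=0}^\infty a_jz^j\Big)=\sum_{j=0}^\infty \frac{w_{j+1}}{w_j}a_{j+1}z^j .$$ A bounded operator on a Hilbert space $\mathcal H$ is subnormal if it has a normal extension, i.e. it is the restriction to $\mathcal H$ of a bounded normal operator on a Hilbert space containing $\mathcal H$ that leaves $\mathcal H$ invariant. *)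

theory Defs
  imports "HOL-Analysis.Analysis" "HOL-Computational_Algebra.Formal_Power_Series"
begin

section \<open>Complex Hilbert spaces on a carrier set\<close>

text \<open>
  A carrier-based notion is used because the weighted space below depends on the sequence
  \<open>w\<close> and hence cannot be a type. Addition is that of the ambient type; the inner product is
  linear in its first argument.
\<close>

record 'a hspace =
  hcarrier :: "'a set"
  hscale :: "complex \<Rightarrow> 'a \<Rightarrow> 'a"
  hinner :: "'a \<Rightarrow> 'a \<Rightarrow> complex"

definition hnorm :: "'a hspace \<Rightarrow> 'a \<Rightarrow> real" where
  "hnorm H x = sqrt (Re (hinner H x x))"

locale hilbert_space =
  fixes H :: "'a::ab_group_add hspace"
  assumes vector_space: "vector_space (hscale H)"
    and subspace: "module.subspace (hscale H) (hcarrier H)"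
    and inner_commute:
      "\<lbrakk>x \<in> hcarrier H; y \<in> hcarrier H\<rbrakk> \<Longrightarrow> hinner H y x = cnj (hinner H x y)"
    and inner_add_left:
      "\<lbrakk>x \<in> hcarrier H; y \<in> hcarrier H; z \<in> hcarrier H\<rbrakk>
        \<Longrightarrow> hinner H (x + y) z = hinner H x z + hinner H y z"
    and inner_scale_left:
      "\<lbrakk>x \<in> hcarrier H; y \<in> hcarrier H\<rbrakk>
        \<Longrightarrow> hinner H (hscale H c x) y = c * hinner H x y"
    and inner_nonneg: "x \<in> hcarrier H \<Longrightarrow> 0 \<le> Re (hinner H x x)"
    and inner_definite: "\<lbrakk>x \<in> hcarrier H; hinner H x x = 0\<rbrakk> \<Longrightarrow> x = 0"
    and complete:
      "\<lbrakk>\<And>n. X n \<in> hcarrier H; \<forall>e>0. \<exists>M. \<forall>m\<ge>M. \<forall>n\<ge>M. hnorm H (X m - X n) < e\<rbrakk>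
        \<Longrightarrow> \<exists>x\<in>hcarrier H. (\<lambda>n. hnorm H (X n - x)) \<longlonglongrightarrow> 0"

definition linear_between ::
    "'a::ab_group_add hspace \<Rightarrow> 'b::ab_group_add hspace \<Rightarrow> ('a \<Rightarrow> 'b) \<Rightarrow> bool" where
  "linear_between H K A \<longleftrightarrow>
     (\<forall>x\<in>hcarrier H. A x \<in> hcarrier K) \<and>
     (\<forall>x\<in>hcarrier H. \<forall>y\<in>hcarrier H. A (x + y) = A x + A y) \<and>
     (\<forall>c. \<forall>x\<in>hcarrier H. A (hscale H c x) = hscale K c (A x))"

definition bounded_operator :: "'a::ab_group_add hspace \<Rightarrow> ('a \<Rightarrow> 'a) \<Rightarrow> bool" where
  "bounded_operator H A \<longleftrightarrow>
     linear_between H H A \<and> (\<exists>C. \<forall>x\<in>hcarrier H. hnorm H (A x) \<le> C * hnorm H x)"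

definition is_adjoint ::
    "'a::ab_group_add hspace \<Rightarrow> ('a \<Rightarrow> 'a) \<Rightarrow> ('a \<Rightarrow> 'a) \<Rightarrow> bool" where
  "is_adjoint H A B \<longleftrightarrow>
     bounded_operator H B \<and>
     (\<forall>x\<in>hcarrier H. \<forall>y\<in>hcarrier H. hinner H (A x) y = hinner H x (B y))"

definition normal_operator :: "'a::ab_group_add hspace \<Rightarrow> ('a \<Rightarrow> 'a) \<Rightarrow> bool" where
  "normal_operator H A \<longleftrightarrow>
     bounded_operator H A \<and>
     (\<exists>B. is_adjoint H A B \<and> (\<forall>x\<in>hcarrier H. A (B x) = B (A x)))"

definition isometric_embedding ::
    "'a::ab_group_add hspace \<Rightarrow> 'b::ab_group_add hspace \<Rightarrow> ('a \<Rightarrow> 'b) \<Rightarrow> bool" where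
  "isometric_embedding H K V \<longleftrightarrow>
     linear_between H K V \<and>
     (\<forall>x\<in>hcarrier H. \<forall>y\<in>hcarrier H. hinner K (V x) (V y) = hinner H x y)"

text \<open>
  The inclusion of \<open>H\<close> into the larger space is an isometric embedding \<open>V\<close>; the equation
  \<open>N (V x) = V (T x)\<close> says that the copy of \<open>H\<close> is invariant under \<open>N\<close> and that \<open>N\<close> restricts
  to \<open>T\<close> on it. HOL cannot quantify existentially over types, so the type \<open>'k\<close> in which the
  larger space lives is a parameter: an operator is not subnormal if this predicate fails for
  every \<open>'k\<close>. The predicate is meant for a bounded operator \<open>T\<close> on a Hilbert space \<open>H\<close>.
\<close>

definition subnormal ::
    "'k::ab_group_add itself \<Rightarrow> 'a::ab_group_add hspace \<Rightarrow> ('a \<Rightarrow> 'a) \<Rightarrow> bool" where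
  "subnormal (_ :: 'k itself) H T \<longleftrightarrow>
     (\<exists>(K :: 'k hspace) N V.
        hilbert_space K \<and> normal_operator K N \<and> isometric_embedding H K V \<and>
        (\<forall>x\<in>hcarrier H. N (V x) = V (T x)))"

lemma normal_imp_subnormal:
  fixes H :: "'a::ab_group_add hspace"
  assumes "hilbert_space H" "normal_operator H A"
  shows "subnormal TYPE('a) H A"
  unfolding subnormal_def
  using assms
  by (intro exI[of _ H] exI[of _ A] exI[of _ "\<lambda>x. x"])
     (auto simp: isometric_embedding_def linear_between_def)


section \<open>The weighted space and the backward shift\<close>

definition H2w :: "(nat \<Rightarrow> real) \<Rightarrow> complex fps hspace" where
  "H2w w = \<lparr>
     hcarrier = {f. summable (\<lambda>j. (cmod (fps_nth f j))\<^sup>2 * w j)},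
     hscale = (\<lambda>c f. fps_const c * f),
     hinner = (\<lambda>f g. \<Sum>j. fps_nth f j * cnj (fps_nth g j) * complex_of_real (w j))\<rparr>"

definition backward_shift :: "(nat \<Rightarrow> real) \<Rightarrow> complex fps \<Rightarrow> complex fps" where
  "backward_shift w f =
     Abs_fps (\<lambda>j. complex_of_real (w (Suc j) / w j) * fps_nth f (Suc j))"


subsection \<open>These are a Hilbert space and the adjoint of the forward shift\<close>

context
  fixes w :: "nat \<Rightarrow> real"
  assumes w_pos: "\<And>j. w j > 0"
begin

lemma H2w_mem: "f \<in> hcarrier (H2w w) \<longleftrightarrow> summable (\<lambda>j. (cmod (fps_nth f j))\<^sup>2 * w j)"
  by (simp add: H2w_def)

lemma H2w_add:
  assumes "f \<in> hcarrier (H2w w)" "g \<in> hcarrier (H2w w)"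
  shows "f + g \<in> hcarrier (H2w w)"
proof -
  have "summable (\<lambda>j. 2 * ((cmod (fps_nth f j))\<^sup>2 * w j) + 2 * ((cmod (fps_nth g j))\<^sup>2 * w j))"
    using assms by (intro summable_add summable_mult) (auto simp: H2w_mem)
  moreover have "norm ((cmod (fps_nth (f + g) j))\<^sup>2 * w j)
      \<le> 2 * ((cmod (fps_nth f j))\<^sup>2 * w j) + 2 * ((cmod (fps_nth g j))\<^sup>2 * w j)" for j
  proof -
    have "(cmod (fps_nth f j + fps_nth g j))\<^sup>2 \<le> (cmod (fps_nth f j) + cmod (fps_nth g j))\<^sup>2"
      by (intro power_mono norm_triangle_ineq) auto
    also have "\<dots> \<le> 2 * (cmod (fps_nth f j))\<^sup>2 + 2 * (cmod (fps_nth g j))\<^sup>2"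
      using zero_le_power2[of "cmod (fps_nth f j) - cmod (fps_nth g j)"]
      by (simp add: power2_eq_square algebra_simps)
    finally show ?thesis
      using w_pos[of j] mult_right_mono[of _ _ "w j"]
      by (fastforce simp: algebra_simps abs_mult)
  qed
  ultimately show ?thesis
    unfolding H2w_mem by (rule summable_comparison_test'[where N = 0])
qed

lemma H2w_scale:
  assumes "f \<in> hcarrier (H2w w)"
  shows "fps_const c * f \<in> hcarrier (H2w w)"
  using summable_mult[OF assms[unfolded H2w_mem], of "(cmod c)\<^sup>2"]
  by (simp add: H2w_mem norm_mult power_mult_distrib mult.assoc)

lemma H2w_diff:
  assumes "f \<in> hcarrier (H2w w)" "g \<in> hcarrier (H2w w)"
  shows "f - g \<in> hcarrier (H2w w)"
proof -
  have "- g \<in> hcarrier (H2w w)"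
    using assms(2) by (simp add: H2w_mem)
  from H2w_add[OF assms(1) this] show ?thesis by simp
qed

lemma H2w_inner_summable:
  assumes "f \<in> hcarrier (H2w w)" "g \<in> hcarrier (H2w w)"
  shows "summable (\<lambda>j. fps_nth f j * cnj (fps_nth g j) * complex_of_real (w j))"
proof -
  have "summable (\<lambda>j. (cmod (fps_nth f j))\<^sup>2 * w j + (cmod (fps_nth g j))\<^sup>2 * w j)"
    using assms by (intro summable_add) (auto simp: H2w_mem)
  moreover have "norm (fps_nth f j * cnj (fps_nth g j) * complex_of_real (w j))
      \<le> (cmod (fps_nth f j))\<^sup>2 * w j + (cmod (fps_nth g j))\<^sup>2 * w j" for j
  proof -
    have "cmod (fps_nth f j) * cmod (fps_nth g j) \<le> (cmod (fps_nth f j))\<^sup>2 + (cmod (fps_nth g j))\<^sup>2"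
      using sum_squares_bound[of "cmod (fps_nth f j)" "cmod (fps_nth g j)"]
        mult_nonneg_nonneg[of "cmod (fps_nth f j)" "cmod (fps_nth g j)"]
      by (simp del: mult_nonneg_nonneg)
    from mult_right_mono[OF this, of "w j"] show ?thesis
      using w_pos[of j] by (simp add: norm_mult algebra_simps)
  qed
  ultimately show ?thesis
    by (rule summable_comparison_test'[where N = 0])
qed

lemma H2w_inner_self:
  assumes "f \<in> hcarrier (H2w w)"
  shows "hinner (H2w w) f f = complex_of_real (\<Sum>j. (cmod (fps_nth f j))\<^sup>2 * w j)"
proof -
  have "(\<lambda>j. complex_of_real ((cmod (fps_nth f j))\<^sup>2 * w j))
      = (\<lambda>j. fps_nth f j * cnj (fps_nth f j) * complex_of_real (w j))"
    by (simp add: complex_norm_square[symmetric])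
  then show ?thesis
    using suminf_of_real[OF assms[unfolded H2w_mem], where 'a = complex] by (simp add: H2w_def)
qed

lemma H2w_norm_square:
  assumes "f \<in> hcarrier (H2w w)"
  shows "(hnorm (H2w w) f)\<^sup>2 = (\<Sum>j. (cmod (fps_nth f j))\<^sup>2 * w j)"
    and "hnorm (H2w w) f \<ge> 0"
proof -
  have "(\<Sum>j. (cmod (fps_nth f j))\<^sup>2 * w j) \<ge> 0"
    using assms w_pos by (intro suminf_nonneg) (auto simp: H2w_mem less_imp_le)
  then show "(hnorm (H2w w) f)\<^sup>2 = (\<Sum>j. (cmod (fps_nth f j))\<^sup>2 * w j)" "hnorm (H2w w) f \<ge> 0"
    by (auto simp: hnorm_def H2w_inner_self[OF assms])
qed

lemma H2w_partial_sum_le: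
  assumes "f \<in> hcarrier (H2w w)"
  shows "(\<Sum>j<k. (cmod (fps_nth f j))\<^sup>2 * w j) \<le> (hnorm (H2w w) f)\<^sup>2"
  unfolding H2w_norm_square(1)[OF assms]
  using assms w_pos by (intro sum_le_suminf) (auto simp: H2w_mem less_imp_le)

lemma H2w_of_partial_sums:
  assumes "\<And>k. (\<Sum>j<k. (cmod (fps_nth f j))\<^sup>2 * w j) \<le> B\<^sup>2" "B \<ge> 0"
  shows "f \<in> hcarrier (H2w w)" "hnorm (H2w w) f \<le> B"
proof -
  show *: "f \<in> hcarrier (H2w w)"
    unfolding H2w_mem using assms(1) w_pos
    by (intro summableI_nonneg_bounded[where x = "B\<^sup>2"]) (auto simp: less_imp_le)
  have "(hnorm (H2w w) f)\<^sup>2 \<le> B\<^sup>2"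
    unfolding H2w_norm_square(1)[OF *]
    using * assms(1) by (intro suminf_le_const) (auto simp: H2w_mem)
  then show "hnorm (H2w w) f \<le> B"
    using assms(2) by (rule power2_le_imp_le)
qed

lemma H2w_complete:
  assumes mem: "\<And>n. X n \<in> hcarrier (H2w w)"
    and Cauchy: "\<forall>e>0. \<exists>M. \<forall>m\<ge>M. \<forall>n\<ge>M. hnorm (H2w w) (X m - X n) < e"
  shows "\<exists>x\<in>hcarrier (H2w w). (\<lambda>n. hnorm (H2w w) (X n - x)) \<longlonglongrightarrow> 0"
proof -
  have "\<exists>a. (\<lambda>n. fps_nth (X n) j) \<longlonglongrightarrow> a" for j
  proof -
    have "Cauchy (\<lambda>n. fps_nth (X n) j)"
    proof (rule CauchyI)
      fix e :: real assume "e > 0"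
      then have "e * sqrt (w j) > 0" using w_pos by simp
      with Cauchy obtain M where M: "\<And>m n. m \<ge> M \<Longrightarrow> n \<ge> M \<Longrightarrow>
          hnorm (H2w w) (X m - X n) < e * sqrt (w j)" by meson
      show "\<exists>M. \<forall>m\<ge>M. \<forall>n\<ge>M. norm (fps_nth (X m) j - fps_nth (X n) j) < e"
      proof (intro exI allI impI)
        fix m n assume mn: "m \<ge> M" "n \<ge> M"
        have D: "X m - X n \<in> hcarrier (H2w w)" using mem H2w_diff by blast
        have "(cmod (fps_nth (X m - X n) j) * sqrt (w j))\<^sup>2
            = (cmod (fps_nth (X m - X n) j))\<^sup>2 * w j"
          using w_pos[of j] by (simp add: power_mult_distrib)
        also have "\<dots> \<le> (\<Sum>i<Suc j. (cmod (fps_nth (X m - X n) i))\<^sup>2 * w i)"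
          using w_pos by (intro member_le_sum) (auto simp: less_imp_le)
        also have "\<dots> \<le> (hnorm (H2w w) (X m - X n))\<^sup>2" by (rule H2w_partial_sum_le[OF D])
        finally have "cmod (fps_nth (X m - X n) j) * sqrt (w j) \<le> hnorm (H2w w) (X m - X n)"
          using H2w_norm_square(2)[OF D] power2_le_imp_le by blast
        also have "\<dots> < e * sqrt (w j)" using M mn by blast
        finally show "norm (fps_nth (X m) j - fps_nth (X n) j) < e"
          using w_pos[of j] by simp
      qed
    qed
    then show ?thesis
      by (simp add: Cauchy_convergent_iff convergent_def)
  qed
  then obtain a where a: "\<And>j. (\<lambda>n. fps_nth (X n) j) \<longlonglongrightarrow> a j" by metis
  define x where "x = Abs_fps a"
  have close: "\<exists>M. \<forall>m\<ge>M. X m - x \<in> hcarrier (H2w w) \<and> hnorm (H2w w) (X m - x) \<le> e"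
    if "e > 0" for e
  proof -
    from Cauchy that obtain M where M: "\<And>m n. m \<ge> M \<Longrightarrow> n \<ge> M \<Longrightarrow>
        hnorm (H2w w) (X m - X n) < e" by meson
    have "(\<Sum>j<k. (cmod (fps_nth (X m - x) j))\<^sup>2 * w j) \<le> e\<^sup>2" if "m \<ge> M" for m k
    proof (rule tendsto_upperbound)
      show "(\<lambda>n. \<Sum>j<k. (cmod (fps_nth (X m - X n) j))\<^sup>2 * w j)
          \<longlonglongrightarrow> (\<Sum>j<k. (cmod (fps_nth (X m - x) j))\<^sup>2 * w j)"
        by (auto simp: x_def intro!: tendsto_intros a)
      show "\<forall>\<^sub>F n in sequentially. (\<Sum>j<k. (cmod (fps_nth (X m - X n) j))\<^sup>2 * w j) \<le> e\<^sup>2"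
        unfolding eventually_sequentially
      proof (intro exI allI impI)
        fix n assume n: "n \<ge> M"
        have D: "X m - X n \<in> hcarrier (H2w w)" using mem H2w_diff by blast
        have "(hnorm (H2w w) (X m - X n))\<^sup>2 \<le> e\<^sup>2"
          using M[OF \<open>m \<ge> M\<close> n] H2w_norm_square(2)[OF D] by (intro power_mono) auto
        with H2w_partial_sum_le[OF D, of k]
        show "(\<Sum>j<k. (cmod (fps_nth (X m - X n) j))\<^sup>2 * w j) \<le> e\<^sup>2" by linarith
      qed
    qed auto
    then show ?thesis
      using H2w_of_partial_sums[of "X _ - x" e] that by (intro exI[of _ M]) auto
  qed
  from close[of 1] obtain m where m: "X m - x \<in> hcarrier (H2w w)" by auto
  have "x \<in> hcarrier (H2w w)"
    using H2w_diff[OF mem[of m] m] by simp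
  moreover have "(\<lambda>n. hnorm (H2w w) (X n - x)) \<longlonglongrightarrow> 0"
  proof (rule LIMSEQ_I)
    fix e :: real assume "e > 0"
    with close[of "e / 2"] obtain M where
      "\<forall>m\<ge>M. X m - x \<in> hcarrier (H2w w) \<and> hnorm (H2w w) (X m - x) \<le> e / 2" by auto
    with \<open>e > 0\<close> H2w_norm_square(2)
    show "\<exists>M. \<forall>n\<ge>M. norm (hnorm (H2w w) (X n - x) - 0) < e"
      by (intro exI[of _ M]) fastforce
  qed
  ultimately show ?thesis by blast
qed

lemma hilbert_space_H2w: "hilbert_space (H2w w)"
proof (rule hilbert_space.intro)
  have sc: "hscale (H2w w) = (\<lambda>c f. fps_const c * f)" by (simp add: H2w_def)
  show vs: "vector_space (hscale (H2w w))"
    unfolding sc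
    by (rule vector_space.intro)
      (simp_all add: algebra_simps flip: fps_const_add fps_const_mult)
  interpret vector_space "hscale (H2w w)" by (fact vs)
  show "module.subspace (hscale (H2w w)) (hcarrier (H2w w))"
    unfolding subspace_def using H2w_add H2w_scale
    by (auto simp: sc) (simp add: H2w_mem)
  fix x y z c
  assume x: "x \<in> hcarrier (H2w w)"
  show "0 \<le> Re (hinner (H2w w) x x)"
    using x w_pos by (auto simp: H2w_inner_self H2w_mem less_imp_le intro!: suminf_nonneg)
  show "x = 0" if "hinner (H2w w) x x = 0"
  proof -
    have "(\<Sum>j. (cmod (fps_nth x j))\<^sup>2 * w j) = 0"
      using that by (simp add: H2w_inner_self[OF x])
    then have "(cmod (fps_nth x j))\<^sup>2 * w j = 0" for j
      using x w_pos by (subst (asm) suminf_eq_zero_iff) (auto simp: H2w_mem less_imp_le)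
    then show ?thesis
      using w_pos by (auto simp: fps_eq_iff) (metis less_irrefl)
  qed
  assume y: "y \<in> hcarrier (H2w w)"
  show "hinner (H2w w) y x = cnj (hinner (H2w w) x y)"
  proof -
    have "(\<lambda>j. cnj (fps_nth x j * cnj (fps_nth y j) * complex_of_real (w j)))
        sums cnj (\<Sum>j. fps_nth x j * cnj (fps_nth y j) * complex_of_real (w j))"
      unfolding sums_cnj using H2w_inner_summable[OF x y] by (rule summable_sums)
    from sums_unique[OF this] show ?thesis
      by (simp add: H2w_def mult.commute)
  qed
  show "hinner (H2w w) (hscale (H2w w) c x) y = c * hinner (H2w w) x y"
    using suminf_mult[OF H2w_inner_summable[OF x y], of c]
    by (simp add: H2w_def mult.assoc)
  assume z: "z \<in> hcarrier (H2w w)"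
  show "hinner (H2w w) (x + y) z = hinner (H2w w) x z + hinner (H2w w) y z"
    using suminf_add[OF H2w_inner_summable[OF x z] H2w_inner_summable[OF y z]]
    by (simp add: H2w_def algebra_simps)
qed (use H2w_complete in auto)

context
  assumes bdd: "bdd_above (range (\<lambda>j. w (Suc j) / w j))"
begin

lemma ratio_bound: obtains C where "C \<ge> 0" "\<And>j. w (Suc j) \<le> C * w j"
proof -
  from bdd obtain C where C: "\<And>j. w (Suc j) / w j \<le> C" by (auto simp: bdd_above_def)
  have "w 1 / w 0 > 0" using w_pos by simp
  with C[of 0] have "C \<ge> 0" by simp
  moreover have "w (Suc j) \<le> C * w j" for j
    using C[of j] w_pos[of j] by (simp add: divide_simps)
  ultimately show ?thesis using that by blast
qed

lemma bounded_operator_forward_shift: "bounded_operator (H2w w) (\<lambda>f. fps_X * f)"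
proof -
  obtain C where C: "C \<ge> 0" "\<And>j. w (Suc j) \<le> C * w j" using ratio_bound by blast
  have B: "fps_X * f \<in> hcarrier (H2w w) \<and>
      hnorm (H2w w) (fps_X * f) \<le> sqrt C * hnorm (H2w w) f"
    if f: "f \<in> hcarrier (H2w w)" for f
  proof -
    have "(\<Sum>j<k. (cmod (fps_nth (fps_X * f) j))\<^sup>2 * w j) \<le> (sqrt C * hnorm (H2w w) f)\<^sup>2" for k
    proof -
      have "(\<Sum>j<k. (cmod (fps_nth (fps_X * f) j))\<^sup>2 * w j)
          \<le> (\<Sum>j<Suc k. (cmod (fps_nth (fps_X * f) j))\<^sup>2 * w j)"
        using w_pos[of k] by simp
      also have "\<dots> = (\<Sum>j<k. (cmod (fps_nth f j))\<^sup>2 * w (Suc j))"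
        by (subst sum.lessThan_Suc_shift) simp
      also have "\<dots> \<le> (\<Sum>j<k. C * ((cmod (fps_nth f j))\<^sup>2 * w j))"
        using C(2) by (intro sum_mono) (metis mult.left_commute mult_left_mono zero_le_power2)
      also have "\<dots> = C * (\<Sum>j<k. (cmod (fps_nth f j))\<^sup>2 * w j)" by (simp add: sum_distrib_left)
      also have "\<dots> \<le> C * (hnorm (H2w w) f)\<^sup>2"
        by (intro mult_left_mono H2w_partial_sum_le f C(1))
      finally show ?thesis using C(1) by (simp add: power_mult_distrib)
    qed
    then show ?thesis
      using H2w_of_partial_sums[of "fps_X * f" "sqrt C * hnorm (H2w w) f"]
        C(1) H2w_norm_square(2)[OF f] by auto
  qed
  then have "\<exists>C. \<forall>f\<in>hcarrier (H2w w). hnorm (H2w w) (fps_X * f) \<le> C * hnorm (H2w w) f" by blast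
  moreover have "linear_between (H2w w) (H2w w) (\<lambda>f. fps_X * f)"
    using B by (simp add: linear_between_def algebra_simps) (simp add: H2w_def algebra_simps)
  ultimately show ?thesis by (simp add: bounded_operator_def)
qed

lemma bounded_operator_backward_shift: "bounded_operator (H2w w) (backward_shift w)"
proof -
  obtain C where C: "C \<ge> 0" "\<And>j. w (Suc j) \<le> C * w j" using ratio_bound by blast
  have B: "backward_shift w f \<in> hcarrier (H2w w) \<and>
      hnorm (H2w w) (backward_shift w f) \<le> sqrt C * hnorm (H2w w) f"
    if f: "f \<in> hcarrier (H2w w)" for f
  proof -
    have "(\<Sum>j<k. (cmod (fps_nth (backward_shift w f) j))\<^sup>2 * w j)
        \<le> (sqrt C * hnorm (H2w w) f)\<^sup>2" for k
    proof -
      have "(cmod (fps_nth (backward_shift w f) j))\<^sup>2 * w j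
          \<le> C * ((cmod (fps_nth f (Suc j)))\<^sup>2 * w (Suc j))" for j
      proof -
        have "(cmod (fps_nth (backward_shift w f) j))\<^sup>2 * w j
            = (w (Suc j) / w j) * ((cmod (fps_nth f (Suc j)))\<^sup>2 * w (Suc j))"
          using w_pos[of j] w_pos[of "Suc j"]
          by (simp add: backward_shift_def norm_mult norm_divide power2_eq_square field_simps)
        also have "\<dots> \<le> C * ((cmod (fps_nth f (Suc j)))\<^sup>2 * w (Suc j))"
          using C(2)[of j] w_pos[of j] w_pos[of "Suc j"]
          by (intro mult_right_mono) (auto simp: divide_simps)
        finally show ?thesis .
      qed
      then have "(\<Sum>j<k. (cmod (fps_nth (backward_shift w f) j))\<^sup>2 * w j)
          \<le> (\<Sum>j<k. C * ((cmod (fps_nth f (Suc j)))\<^sup>2 * w (Suc j)))" by (intro sum_mono)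
      also have "\<dots> = C * (\<Sum>j<k. (cmod (fps_nth f (Suc j)))\<^sup>2 * w (Suc j))"
        by (simp add: sum_distrib_left)
      also have "\<dots> \<le> C * (\<Sum>j<Suc k. (cmod (fps_nth f j))\<^sup>2 * w j)"
        using w_pos[of 0] by (subst sum.lessThan_Suc_shift) (intro mult_left_mono C(1), simp)
      also have "\<dots> \<le> C * (hnorm (H2w w) f)\<^sup>2"
        by (intro mult_left_mono H2w_partial_sum_le f C(1))
      finally show ?thesis using C(1) by (simp add: power_mult_distrib)
    qed
    then show ?thesis
      using H2w_of_partial_sums[of "backward_shift w f" "sqrt C * hnorm (H2w w) f"]
        C(1) H2w_norm_square(2)[OF f] by auto
  qed
  then have "\<exists>C. \<forall>f\<in>hcarrier (H2w w). hnorm (H2w w) (backward_shift w f) \<le> C * hnorm (H2w w) f"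
    by blast
  moreover have "linear_between (H2w w) (H2w w) (backward_shift w)"
    using B by (simp add: linear_between_def)
      (auto simp: H2w_def backward_shift_def fps_eq_iff algebra_simps)
  ultimately show ?thesis by (simp add: bounded_operator_def)
qed

lemma backward_shift_is_adjoint: "is_adjoint (H2w w) (\<lambda>f. fps_X * f) (backward_shift w)"
  unfolding is_adjoint_def
proof (intro conjI ballI bounded_operator_backward_shift)
  fix f g assume f: "f \<in> hcarrier (H2w w)" and g: "g \<in> hcarrier (H2w w)"
  have "fps_X * f \<in> hcarrier (H2w w)"
    using f bounded_operator_forward_shift by (auto simp: bounded_operator_def linear_between_def)
  from suminf_split_head[OF H2w_inner_summable[OF this g]]
  have "hinner (H2w w) (fps_X * f) g
      = (\<Sum>j. fps_nth f j * cnj (fps_nth g (Suc j)) * complex_of_real (w (Suc j)))"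
    by (simp add: H2w_def)
  also have "\<dots> = hinner (H2w w) f (backward_shift w g)"
    using w_pos by (simp add: H2w_def backward_shift_def less_imp_neq[symmetric] mult_ac)
  finally show "hinner (H2w w) (fps_X * f) g = hinner (H2w w) f (backward_shift w g)" .
qed

end

end

end

theory Submission
  imports Defs
begin

text \<open>
  A normal operator \<open>N\<close> satisfies \<open>\<parallel>N x\<parallel> = \<parallel>N\<^sup>* x\<parallel>\<close>, so its kernel lies in the kernel of
  \<open>N\<^sup>*\<close>, which is the orthogonal complement of its range. Orthogonality of kernel and range
  passes to restrictions to invariant subspaces, hence holds for every subnormal operator. The
  backward shift violates it: the constant function \<open>1\<close> is in its kernel and, being a nonzero
  multiple of the image of \<open>z\<close>, also in its range. This is the simplest instance of the failure
  of hyponormality \<open>\<parallel>T\<^sup>* x\<parallel> \<le> \<parallel>T x\<parallel>\<close>, tested at \<open>x = 1\<close>.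
\<close>

lemma linear_between_zero:
  assumes "linear_between H K A" and "0 \<in> hcarrier H"
  shows "A 0 = 0"
proof -
  have "A (0 + 0) = A 0 + A 0"
    using assms unfolding linear_between_def by blast
  then show ?thesis by simp
qed

context hilbert_space
begin

lemma zero_mem: "0 \<in> hcarrier H"
proof -
  interpret vector_space "hscale H" by (fact vector_space)
  show ?thesis using subspace by (rule subspace_0)
qed

lemma inner_zero_left: "x \<in> hcarrier H \<Longrightarrow> hinner H 0 x = 0"
  using inner_add_left[OF zero_mem zero_mem, of x] by simp

lemma inner_zero_right: "x \<in> hcarrier H \<Longrightarrow> hinner H x 0 = 0"
  using inner_commute[OF zero_mem] inner_zero_left by simp

text \<open>
  With \<open>B\<close> the adjoint of \<open>A\<close>, normality gives
  \<open>\<parallel>B v\<parallel>\<^sup>2 = \<langle>A (B v), v\<rangle> = \<langle>B (A v), v\<rangle> = 0\<close> for \<open>v\<close> in the kernel of \<open>A\<close>; thus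
  \<open>\<langle>A x, v\<rangle> = \<langle>x, B v\<rangle> = 0\<close>.
\<close>

lemma normal_kernel_orthogonal_range:
  assumes "normal_operator H A" and x: "x \<in> hcarrier H" and v: "v \<in> hcarrier H"
    and ker: "A v = 0"
  shows "hinner H (A x) v = 0"
proof -
  from assms(1) obtain B where adj: "is_adjoint H A B"
    and comm: "A (B v) = B (A v)"
    using v unfolding normal_operator_def by blast
  have lin: "linear_between H H B"
    using adj unfolding is_adjoint_def bounded_operator_def by blast
  then have Bv: "B v \<in> hcarrier H"
    using v unfolding linear_between_def by blast
  have swap: "hinner H (A y) v = hinner H y (B v)" if "y \<in> hcarrier H" for y
    using adj that v unfolding is_adjoint_def by blast
  have "hinner H (B v) (B v) = hinner H (B (A v)) v"
    using swap[OF Bv] comm by simp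
  also have "\<dots> = 0"
    using ker linear_between_zero[OF lin zero_mem] inner_zero_left[OF v] by simp
  finally have "B v = 0"
    using Bv inner_definite by blast
  then show ?thesis
    using swap[OF x] inner_zero_right[OF x] by simp
qed

lemma subnormal_kernel_orthogonal_range:
  assumes "subnormal TYPE('k::ab_group_add) H T"
    and lin: "linear_between H H T"
    and x: "x \<in> hcarrier H" and v: "v \<in> hcarrier H" and ker: "T v = 0"
  shows "hinner H (T x) v = 0"
proof -
  from assms(1) obtain K :: "'k hspace" and N V
    where K: "hilbert_space K" and N: "normal_operator K N"
      and V: "isometric_embedding H K V"
      and ext: "\<And>y. y \<in> hcarrier H \<Longrightarrow> N (V y) = V (T y)"
    unfolding subnormal_def by blast
  have linV: "linear_between H K V"
    and iso: "\<And>y u. \<lbrakk>y \<in> hcarrier H; u \<in> hcarrier H\<rbrakk> \<Longrightarrow> hinner K (V y) (V u) = hinner H y u"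
    using V unfolding isometric_embedding_def by blast+
  have mem: "V x \<in> hcarrier K" "V v \<in> hcarrier K" "T x \<in> hcarrier H"
    using linV lin x v unfolding linear_between_def by blast+
  have "N (V v) = 0"
    using ext[OF v] ker linear_between_zero[OF linV zero_mem] by simp
  then have "hinner K (N (V x)) (V v) = 0"
    by (rule hilbert_space.normal_kernel_orthogonal_range[OF K N mem(1,2)])
  then show ?thesis
    using ext[OF x] iso[OF mem(3) v] by simp
qed

end

theorem corollary1p5:
  fixes w :: "nat \<Rightarrow> real"
  assumes "\<And>j. w j > 0"
    and "liminf (\<lambda>j. ereal (\<bar>w j\<bar> powr (1 / real j))) = 1"
    and "bdd_above (range (\<lambda>j. w (Suc j) / w j))"
  shows "\<not> subnormal TYPE('k::ab_group_add) (H2w w) (backward_shift w)"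
proof
  assume sub: "subnormal TYPE('k) (H2w w) (backward_shift w)"
  have lin: "linear_between (H2w w) (H2w w) (backward_shift w)"
    using bounded_operator_backward_shift[OF assms(1,3)]
    unfolding bounded_operator_def by blast
  have z: "fps_X \<in> hcarrier (H2w w)"
    unfolding H2w_mem[OF assms(1)]
    by (rule summable_finite[of "{1}"]) auto
  have one: "1 \<in> hcarrier (H2w w)"
    unfolding H2w_mem[OF assms(1)]
    by (rule summable_finite[of "{0}"]) auto
  have ker: "backward_shift w 1 = 0"
    by (simp add: backward_shift_def fps_eq_iff)
  have "hinner (H2w w) (backward_shift w fps_X) 1 = 0"
    using hilbert_space.subnormal_kernel_orthogonal_range
      [OF hilbert_space_H2w[OF assms(1)] sub lin z one ker] .
  moreover have "hinner (H2w w) (backward_shift w fps_X) 1 = complex_of_real (w 1)"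
  proof -
    have "hinner (H2w w) (backward_shift w fps_X) 1
        = (\<Sum>j. if j = 0 then complex_of_real (w 1) else 0)"
      unfolding H2w_def hspace.simps
      by (rule arg_cong[where f = suminf])
        (use assms(1)[of 0] in \<open>auto simp: backward_shift_def fun_eq_iff\<close>)
    also have "\<dots> = complex_of_real (w 1)"
      using suminf_finite[of "{0::nat}" "\<lambda>j. if j = 0 then complex_of_real (w 1) else 0"] by simp
    finally show ?thesis .
  qed
  ultimately show False
    using assms(1)[of 1] by simp
qed

end
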